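(* Let $C_1 = C_2 = C \in \mathbb{R}^{m\times n}$ and $R_1 = R_2 = R \in \mathbb{R}^{m\times m}$. Let $f:[0,1]\to[0,1]$ be twice differentiable, convex, and decreasing, with $f(0)=1$. Then the base station is optimally located at one of the sensor positions; that is, there is $d^\star \in \{0,1\}$ such that, for every admissible $P_k$ and every $d\in[0,1]$, the expected error covariance $J_{k+1}(d) = \mathbf{E}[P_{k+1}\mid P_k]$ for base station location $d$ satisfies $J_{k+1}(d) \succeq J_{k+1}(d^\star)$.
   Context: $X\succeq Y$ (Loewner order) means $X-Y$ is positive semidefinite; $M^*$ is the conjugate transpose. Process: $x_{k+1}=Ax_k+w_k$ in $\mathbb{R}^n$, $A$ real $n\times n$, with $w$ independent zero-mean Gaussian of covariance $Q\succeq 0$. Two sensors $s_1,s_2$, located at $0$ and $1$ on the real line, measure $y_k^i = C_i x_k + v_k^i$, $i=1,2$, where $C_i\in\mathbb{R}^{m\times n}$ and $v^i$ is independent zero-mean Gaussian noise of covariance $R_i\succeq 0$ ($m\times m$); $w,v^1,v^2$ are uncorrelated. A base station at $d\in[0,1]$ runs the Kalman filter on the packets received. At each time the packet from $s_1$ is received with probability $f(d)$ and that from $s_2$ with probability $f(1-d)$, independently. Given the real symmetric positive semidefinite $n \times n$ error covariance $P_k$, if the set of received packets is $\omega\subseteq\{1,2\}$, then $P_{k+1}=AP_kA^*+Q$ if $\omega=\emptyset$, and $P_{k+1} = AP_kA^*+Q-M_\omega$ otherwise, where $M_\omega = AP_kF_\omega^*(F_\omega P_kF_\omega^*+G_\omega)^{-1}F_\omega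 P_kA^*$, with $F_\omega$ the vertical stacking of the $C_j$, $j\in\omega$, and $G_\omega$ the block diagonal matrix with blocks $R_j$, $j\in\omega$. $P_k$ is called admissible if it is positive semidefinite and all inverses appearing here exist. Hence $$J_{k+1}(d)=\mathbf{E}[P_{k+1}\mid P_k] = AP_kA^*+Q - f(d)f(1-d)M_{\{1,2\}} - f(d)(1-f(1-d))M_{\{1\}} - (1-f(d))f(1-d)M_{\{2\}}.$$ The base station location is optimal if it minimizes $\mathbf{E}[P_{k+1}\mid P_k]$ over $d\in[0,1]$ in the Loewner order, for any $P_k$. *)

theory Defs
  imports "HOL-Analysis.Analysis" "HOL-Probability.Probability"
begin

definition psd :: "real^'n^'n \<Rightarrow> bool" where
  "psd M \<longleftrightarrow> transpose M = M \<and> (\<forall>x. 0 \<le> x \<bullet> (M *v x))"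

definition loewner_le :: "real^'n^'n \<Rightarrow> real^'n^'n \<Rightarrow> bool"  (infix "\<preceq>\<^sub>L" 50) where
  "X \<preceq>\<^sub>L Y \<longleftrightarrow> psd (Y - X)"

definition twice_differentiable_on :: "(real \<Rightarrow> real) \<Rightarrow> real set \<Rightarrow> bool" where
  "twice_differentiable_on f S \<longleftrightarrow>
     (\<exists>f'. (\<forall>x\<in>S. (f has_real_derivative f' x) (at x within S)) \<and> f' differentiable_on S)"

definition vstack :: "real^'n^'k \<Rightarrow> real^'n^'l \<Rightarrow> real^'n^('k + 'l)" where
  "vstack C1 C2 = (\<chi> i. case i of Inl a \<Rightarrow> C1 $ a | Inr b \<Rightarrow> C2 $ b)"

definition block_diag :: "real^'k^'k \<Rightarrow> real^'l^'l \<Rightarrow> real^('k + 'l)^('k + 'l)" where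
  "block_diag R1 R2 = (\<chi> i j. case (i, j) of
       (Inl a, Inl b) \<Rightarrow> R1 $ a $ b
     | (Inr a, Inr b) \<Rightarrow> R2 $ a $ b
     | _ \<Rightarrow> 0)"

definition innovation_cov :: "real^'n^'n \<Rightarrow> real^'n^'k \<Rightarrow> real^'k^'k \<Rightarrow> real^'k^'k" where
  "innovation_cov P F G = F ** P ** transpose F + G"

definition cov_reduction ::
  "real^'n^'n \<Rightarrow> real^'n^'n \<Rightarrow> real^'n^'k \<Rightarrow> real^'k^'k \<Rightarrow> real^'n^'n" where
  "cov_reduction A P F G =
     A ** P ** transpose F ** matrix_inv (innovation_cov P F G) ** F ** P ** transpose A"

(* The error covariance after one Kalman step from P, when w is the set of sensors (1 or 2)
   whose packets have arrived.  The stacked observation matrix has a different row type in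
   each case, hence the case distinction. *)
definition kalman_update ::
  "real^'n^'n \<Rightarrow> real^'n^'n \<Rightarrow> real^'n^'m \<Rightarrow> real^'n^'m \<Rightarrow> real^'m^'m \<Rightarrow> real^'m^'m
     \<Rightarrow> real^'n^'n \<Rightarrow> nat set \<Rightarrow> real^'n^'n" where
  "kalman_update A Q C1 C2 R1 R2 P w =
     A ** P ** transpose A + Q -
       (if 1 \<in> w \<and> 2 \<in> w then cov_reduction A P (vstack C1 C2) (block_diag R1 R2)
        else if 1 \<in> w then cov_reduction A P C1 R1
        else if 2 \<in> w then cov_reduction A P C2 R2
        else 0)"

(* matrix_inv is a total function, so invertibility has to be demanded explicitly. *)
definition admissible ::
  "real^'n^'m \<Rightarrow> real^'n^'m \<Rightarrow> real^'m^'m \<Rightarrow> real^'m^'m \<Rightarrow> real^'n^'n \<Rightarrow> bool" where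
  "admissible C1 C2 R1 R2 P \<longleftrightarrow>
     psd P \<and>
     invertible (innovation_cov P C1 R1) \<and>
     invertible (innovation_cov P C2 R2) \<and>
     invertible (innovation_cov P (vstack C1 C2) (block_diag R1 R2))"

(* The random set of received packets: sensor 1 is heard with probability p and, independently,
   sensor 2 with probability q. *)
definition received_pmf :: "real \<Rightarrow> real \<Rightarrow> nat set pmf" where
  "received_pmf p q =
     map_pmf (\<lambda>(b1, b2). (if b1 then {1} else {}) \<union> (if b2 then {2} else {}))
       (pair_pmf (bernoulli_pmf p) (bernoulli_pmf q))"

(* The sensors sit at 0 and 1, so a base station at d is at distances d and 1 - d from them. *)
definition expected_cov ::
  "real^'n^'n \<Rightarrow> real^'n^'n \<Rightarrow> real^'n^'m \<Rightarrow> real^'n^'m \<Rightarrow> real^'m^'m \<Rightarrow> real^'m^'m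
     \<Rightarrow> (real \<Rightarrow> real) \<Rightarrow> real^'n^'n \<Rightarrow> real \<Rightarrow> real^'n^'n" where
  "expected_cov A Q C1 C2 R1 R2 f P d =
     measure_pmf.expectation (received_pmf (f d) (f (1 - d))) (kalman_update A Q C1 C2 R1 R2 P)"

lemma expected_cov_eq:
  fixes A Q P :: "real^'n^'n" and C1 C2 :: "real^'n^'m" and R1 R2 :: "real^'m^'m"
  assumes "f d \<in> {0..1}" "f (1 - d) \<in> {0..1}"
  shows "expected_cov A Q C1 C2 R1 R2 f P d =
     A ** P ** transpose A + Q
     - (f d * f (1 - d)) *\<^sub>R cov_reduction A P (vstack C1 C2) (block_diag R1 R2)
     - (f d * (1 - f (1 - d))) *\<^sub>R cov_reduction A P C1 R1
     - ((1 - f d) * f (1 - d)) *\<^sub>R cov_reduction A P C2 R2"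
proof -
  let ?B = "pair_pmf (bernoulli_pmf (f d)) (bernoulli_pmf (f (1 - d)))"
  let ?g = "\<lambda>(b1, b2). kalman_update A Q C1 C2 R1 R2 P
              ((if b1 then {1} else {}) \<union> (if b2 then {2} else {}))"
  have "expected_cov A Q C1 C2 R1 R2 f P d = measure_pmf.expectation ?B ?g"
    unfolding expected_cov_def received_pmf_def integral_map_pmf
    by (rule Bochner_Integration.integral_cong) auto
  also have "\<dots> = (\<Sum>b\<in>UNIV \<times> UNIV. pmf ?B b *\<^sub>R ?g b)"
    by (rule integral_measure_pmf) auto
  also have "\<dots> = (\<Sum>b1\<in>UNIV. \<Sum>b2\<in>UNIV. pmf ?B (b1, b2) *\<^sub>R ?g (b1, b2))"
    by (simp add: sum.cartesian_product case_prod_unfold)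
  finally show ?thesis
    using assms by (simp add: UNIV_bool pmf_pair kalman_update_def algebra_simps)
qed

end

theory Submission
  imports Defs
begin

text \<open>
  Write \<open>M\<^sub>1\<close> and \<open>M\<^sub>2\<close> for the covariance reductions obtained from one and from both packets, and
  \<open>S = C P C\<^sup>T\<close>. Two measurements by identical sensors amount to one measurement with noise covariance
  \<open>R / 2\<close>, so \<open>M\<^sub>1 \<preceq> M\<^sub>2 \<preceq> 2 M\<^sub>1\<close> by comparing the inverses of \<open>S + R\<close> and \<open>S + R / 2\<close>.
  With \<open>p = f d\<close>, \<open>q = f (1 - d)\<close> and \<open>c = f 1\<close>,
  \<open>J(d) - J(0) = (c - p q) (M\<^sub>2 - M\<^sub>1) + (1 - p) (1 - q) M\<^sub>1\<close>. If \<open>c < p q\<close>, this equals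
  \<open>(p q - c) (2 M\<^sub>1 - M\<^sub>2) + (1 + c - p - q) M\<^sub>1\<close>, and convexity gives \<open>p + q \<le> 1 + c\<close>.
\<close>

section \<open>Positive semidefinite matrices\<close>

lemma inner_matrix_vector: "(x::real^'m) \<bullet> (M *v y) = (transpose M *v x) \<bullet> y"
  by (simp add: dot_lmul_matrix)

lemma transpose_add: "transpose (X + Y) = transpose X + transpose (Y :: 'a::plus^'n^'m)"
  by (simp add: transpose_def vec_eq_iff)

lemma transpose_diff: "transpose (X - Y) = transpose X - transpose (Y :: 'a::minus^'n^'m)"
  by (simp add: transpose_def vec_eq_iff)

lemma psd_add: "psd X \<Longrightarrow> psd Y \<Longrightarrow> psd (X + Y)"
  by (simp add: psd_def transpose_add matrix_vector_mult_add_rdistrib inner_add_right)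

lemma psd_scaleR: "0 \<le> c \<Longrightarrow> psd X \<Longrightarrow> psd (c *\<^sub>R X)"
  by (simp add: psd_def transpose_scalar scaleR_matrix_vector_assoc[symmetric])

lemma psd_congruence:
  fixes P :: "real^'n^'n" and F :: "real^'n^'m"
  assumes "psd P"
  shows "psd (F ** P ** transpose F)"
proof -
  have "x \<bullet> (F ** P ** transpose F *v x) = (transpose F *v x) \<bullet> (P *v (transpose F *v x))" for x
    by (simp add: matrix_vector_mul_assoc[symmetric] inner_matrix_vector del: matrix_vector_mul_assoc)
  with assms show ?thesis
    by (simp add: psd_def matrix_transpose_mul matrix_mul_assoc)
qed

text \<open>\<open>matrix_inv\<close> is a choice among two-sided inverses; invertibility guarantees
  that the chosen matrix is one.\<close>

lemma matrix_inv:
  fixes T :: "real^'n^'n"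
  assumes "invertible T"
  shows matrix_inv_right: "T ** matrix_inv T = mat 1"
    and matrix_inv_left: "matrix_inv T ** T = mat 1"
  using assms someI_ex[of "\<lambda>B. T ** B = mat 1 \<and> B ** T = mat 1"]
  by (auto simp: invertible_def matrix_inv_def)

lemma matrix_inv_mult_vector:
  fixes T :: "real^'n^'n"
  assumes "invertible T"
  shows "T *v (matrix_inv T *v u) = u"
  using assms by (simp add: matrix_vector_mul_assoc matrix_inv_right)

lemma invertible_mult_vector_cancel:
  fixes T :: "real^'n^'n"
  assumes "invertible T" "T *v x = T *v y"
  shows "x = y"
  by (metis assms matrix_inv_left matrix_vector_mul_assoc matrix_vector_mul_lid)

lemma transpose_matrix_inv:
  fixes T :: "real^'n^'n"
  assumes "invertible T" "transpose T = T"
  shows "transpose (matrix_inv T) = matrix_inv T"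
proof -
  have "transpose (matrix_inv T) ** T = mat 1"
    by (metis assms matrix_inv_right matrix_transpose_mul transpose_mat)
  then show ?thesis
    by (metis assms(1) matrix_inv_right matrix_mul_assoc matrix_mul_lid matrix_mul_rid)
qed

text \<open>This says \<open>W\<^sup>-\<^sup>1 \<preceq> V\<^sup>-\<^sup>1\<close> for \<open>V \<preceq> W\<close>; it follows from \<open>0 \<le> (v - w) \<bullet> V (v - w)\<close>.\<close>

lemma inner_solution_antimono:
  fixes V W :: "real^'n^'n"
  assumes "psd V" "V *v v = u" "W *v w = u" "w \<bullet> (V *v w) \<le> w \<bullet> (W *v w)"
  shows "u \<bullet> w \<le> u \<bullet> v"
proof -
  have "0 \<le> (v - w) \<bullet> (V *v (v - w))"
    using assms(1) by (simp add: psd_def)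
  moreover have "v \<bullet> (V *v w) = u \<bullet> w"
    using assms(1,2) by (metis inner_matrix_vector psd_def)
  ultimately show ?thesis
    using assms(2-4)
    by (simp add: matrix_vector_mult_diff_distrib inner_diff_left inner_diff_right inner_commute)
qed

section \<open>Covariance reduction by one and by two packets\<close>

definition vjoin :: "'a^'k \<Rightarrow> 'a^'l \<Rightarrow> 'a^('k + 'l)" where
  "vjoin a b = (\<chi> i. case i of Inl k \<Rightarrow> a $ k | Inr l \<Rightarrow> b $ l)"

lemma vjoin_nth [simp]: "vjoin a b $ Inl k = a $ k" "vjoin a b $ Inr l = b $ l"
  by (simp_all add: vjoin_def)

lemma vec_sum_eq_iff:
  fixes x y :: "'a^('k::finite + 'l::finite)"
  shows "x = y \<longleftrightarrow> (\<forall>k. x $ Inl k = y $ Inl k) \<and> (\<forall>l. x $ Inr l = y $ Inr l)"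
  by (metis sum.exhaust vec_eq_iff)

lemma vjoin_surj:
  fixes y :: "'a^('k::finite + 'l::finite)"
  obtains a b where "y = vjoin a b"
proof
  show "y = vjoin (\<chi> k. y $ Inl k) (\<chi> l. y $ Inr l)"
    by (simp add: vec_sum_eq_iff)
qed

lemma vjoin_eq_iff: "vjoin a b = vjoin a' b' \<longleftrightarrow> a = a' \<and> b = b'"
  by (auto simp: vec_sum_eq_iff vec_eq_iff)

lemma vjoin_add: "vjoin a b + vjoin a' b' = vjoin (a + a') (b + b')"
  by (simp add: vec_sum_eq_iff)

lemma sum_UNIV_Plus:
  fixes g :: "'k::finite + 'l::finite \<Rightarrow> 'b::comm_monoid_add"
  shows "(\<Sum>i\<in>UNIV. g i) = (\<Sum>k\<in>UNIV. g (Inl k)) + (\<Sum>l\<in>UNIV. g (Inr l))"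
  by (simp add: UNIV_Plus_UNIV[symmetric] sum.Plus del: UNIV_Plus_UNIV)

lemma inner_vjoin:
  fixes a a' :: "real^'k" and b b' :: "real^'l"
  shows "vjoin a b \<bullet> vjoin a' b' = a \<bullet> a' + b \<bullet> b'"
  by (simp add: inner_vec_def sum_UNIV_Plus)

lemma vstack_mult_vector: "vstack C1 C2 *v x = vjoin (C1 *v x) (C2 *v x)"
  by (simp add: vec_sum_eq_iff matrix_vector_mult_def vstack_def)

lemma transpose_vstack_mult_vjoin:
  "transpose (vstack C1 C2) *v vjoin a b = transpose C1 *v a + transpose C2 *v b"
  by (simp add: vec_eq_iff matrix_vector_mult_def vstack_def transpose_def sum_UNIV_Plus
      del: transpose_matrix_vector)

lemma block_diag_mult_vjoin: "block_diag R1 R2 *v vjoin a b = vjoin (R1 *v a) (R2 *v b)"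
  by (simp add: vec_sum_eq_iff matrix_vector_mult_def block_diag_def sum_UNIV_Plus)

lemma transpose_block_diag: "transpose (block_diag R1 R2) = block_diag (transpose R1) (transpose R2)"
  by (simp add: vec_sum_eq_iff vec_eq_iff transpose_def block_diag_def)

section \<open>Innovation covariances and quadratic forms of covariance reductions\<close>

lemma innovation_cov_mult_vector:
  "innovation_cov P F G *v y = F *v (P *v (transpose F *v y)) + G *v y"
  by (simp add: innovation_cov_def matrix_vector_mult_add_rdistrib matrix_vector_mul_assoc
      matrix_mul_assoc del: transpose_matrix_vector)

text \<open>As both sensors share \<open>C\<close>, the blocks enter the signal term only through
  \<open>a + b\<close>. Swapping \<open>a\<close> and \<open>b\<close> therefore swaps the blocks of
  the result.\<close>

lemma innovation_cov_vstack_mult_vjoin: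
  "innovation_cov P (vstack C C) (block_diag R R) *v vjoin a b =
     vjoin (C *v (P *v (transpose C *v (a + b))) + R *v a)
           (C *v (P *v (transpose C *v (a + b))) + R *v b)"
  unfolding innovation_cov_mult_vector transpose_vstack_mult_vjoin vstack_mult_vector
    block_diag_mult_vjoin vjoin_add matrix_vector_right_distrib ..

lemma psd_innovation_cov: "psd P \<Longrightarrow> psd G \<Longrightarrow> psd (innovation_cov P F G)"
  by (simp add: innovation_cov_def psd_add psd_congruence)

lemma transpose_cov_reduction:
  assumes "transpose P = P" "transpose G = G" "invertible (innovation_cov P F G)"
  shows "transpose (cov_reduction A P F G) = cov_reduction A P F G"
proof -
  have "transpose (innovation_cov P F G) = innovation_cov P F G"
    using assms(1,2)
    by (simp add: innovation_cov_def transpose_add matrix_transpose_mul matrix_mul_assoc)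
  with assms show ?thesis
    by (simp add: cov_reduction_def matrix_transpose_mul matrix_mul_assoc transpose_matrix_inv)
qed

text \<open>Trades the matrix inverse for a solution \<open>y\<close> of a linear system, so that
  reductions with observation spaces of different dimension can be compared through
  solutions.\<close>

lemma quadratic_form_cov_reduction:
  fixes A P :: "real^'n^'n" and F :: "real^'n^'k"
  assumes "transpose P = P" "invertible (innovation_cov P F G)"
    and "innovation_cov P F G *v y = F *v (P *v (transpose A *v x))"
  shows "x \<bullet> (cov_reduction A P F G *v x) = (F *v (P *v (transpose A *v x))) \<bullet> y"
proof -
  let ?u = "F *v (P *v (transpose A *v x))"
  have y: "y = matrix_inv (innovation_cov P F G) *v ?u"
    by (rule invertible_mult_vector_cancel[OF assms(2)])
      (simp only: assms(3) matrix_inv_mult_vector[OF assms(2)])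
  have "x \<bullet> (cov_reduction A P F G *v x) =
      x \<bullet> (A *v (P *v (transpose F *v y)))"
    unfolding y cov_reduction_def by (simp only: matrix_vector_mul_assoc matrix_mul_assoc)
  also have "\<dots> = ?u \<bullet> y"
    by (simp only: inner_matrix_vector assms(1) transpose_transpose)
  finally show ?thesis .
qed

text \<open>With \<open>V = S + R\<close> and \<open>W = 2 S + R\<close>, the quadratic forms are
  \<open>u \<bullet> v\<close> and \<open>2 * (u \<bullet> w)\<close>, where \<open>V v = u\<close>
  and \<open>W w = u\<close>. The bounds follow from V \<le> W \<le> 2V in the Loewner
  order.\<close>

lemma cov_reduction_two_packets:
  fixes A P :: "real^'n^'n" and C :: "real^'n^'m" and R :: "real^'m^'m"
  assumes "psd R" "admissible C C R R P"
  defines "M1 \<equiv> cov_reduction A P C R"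
    and "M2 \<equiv> cov_reduction A P (vstack C C) (block_diag R R)"
  shows psd_cov_reduction: "psd M1"
    and cov_reduction_le_two_packets: "M1 \<preceq>\<^sub>L M2"
    and two_packets_le_twice: "M2 \<preceq>\<^sub>L 2 *\<^sub>R M1"
proof -
  let ?V = "innovation_cov P C R" and ?S = "C ** P ** transpose C"
  let ?T = "innovation_cov P (vstack C C) (block_diag R R)"
  let ?W = "?S + ?V"
  have P: "psd P" "transpose P = P" and inv: "invertible ?V" "invertible ?T"
    using assms(2) by (auto simp: admissible_def psd_def)
  have R: "transpose R = R"
    using assms(1) by (simp add: psd_def)
  have psd: "psd ?S" "psd ?V" "psd ?W"
    using psd_congruence[OF P(1), of C] psd_innovation_cov[OF P(1) assms(1), of C] psd_add
    by blast+
  have sym: "transpose M1 = M1" "transpose M2 = M2"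
    unfolding M1_def M2_def
    by (rule transpose_cov_reduction; simp add: P R inv transpose_block_diag)+
  have quad: "0 \<le> x \<bullet> (M1 *v x) \<and> x \<bullet> (M1 *v x) \<le> x \<bullet> (M2 *v x)
      \<and> x \<bullet> (M2 *v x) \<le> 2 * (x \<bullet> (M1 *v x))" for x
  proof -
    define u where "u = C *v (P *v (transpose A *v x))"
    obtain v where v: "?V *v v = u"
      using matrix_inv_mult_vector[OF inv(1)] by blast
    obtain y where y: "?T *v y = vjoin u u"
      using matrix_inv_mult_vector[OF inv(2)] by blast
    obtain w w' where yw: "y = vjoin w w'"
      by (rule vjoin_surj)
    \<comment> \<open>The right-hand side \<open>vjoin u u\<close> is symmetric, so swapping the
      halves of \<open>y\<close> gives another solution; invertibility of \<open>?T\<close> makes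
      the halves equal. Their common value solves \<open>?W *v w = u\<close>.\<close>
    have "?T *v vjoin w' w = ?T *v vjoin w w'"
      using y unfolding yw innovation_cov_vstack_mult_vjoin
      by (simp add: vjoin_eq_iff add.commute)
    then have "w' = w"
      using invertible_mult_vector_cancel[OF inv(2)] by (metis vjoin_eq_iff)
    with y yw have y': "y = vjoin w w" and "?T *v vjoin w w = vjoin u u"
      by auto
    then have w: "?W *v w = u"
      unfolding innovation_cov_vstack_mult_vjoin vjoin_eq_iff
      by (simp only: matrix_vector_mult_add_rdistrib innovation_cov_mult_vector
          matrix_vector_right_distrib matrix_vector_mul_assoc matrix_mul_assoc add.assoc)
    have M1: "x \<bullet> (M1 *v x) = u \<bullet> v"
      unfolding M1_def u_def
      by (rule quadratic_form_cov_reduction[OF P(2) inv(1)]) (simp only: v u_def)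
    have "x \<bullet> (M2 *v x) = vjoin u u \<bullet> y"
      unfolding M2_def u_def vstack_mult_vector[symmetric]
      by (rule quadratic_form_cov_reduction[OF P(2) inv(2)])
        (simp only: y u_def vstack_mult_vector)
    then have M2: "x \<bullet> (M2 *v x) = 2 * (u \<bullet> w)"
      by (simp add: y' inner_vjoin)
    have "0 \<le> v \<bullet> (?V *v v)"
      using psd(2) by (simp only: psd_def)
    then have "0 \<le> u \<bullet> v"
      by (simp only: v inner_commute)
    moreover have "u \<bullet> w \<le> u \<bullet> v"
      \<comment> \<open>Here V \<le> W because the difference is \<open>?S\<close>.\<close>
      using psd(1) by (intro inner_solution_antimono[OF psd(2) v w])
        (simp only: psd_def matrix_vector_mult_add_rdistrib inner_add_right le_add_same_cancel2)
    \<comment> \<open>Same comparison for W \<le> 2V, whose difference is \<open>R\<close>; half of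
      \<open>v\<close> solves the system with matrix 2V.\<close>
    moreover have "u \<bullet> ((1/2) *\<^sub>R v) \<le> u \<bullet> w"
    proof (rule inner_solution_antimono[OF psd(3) w])
      show "2 *\<^sub>R ?V *v ((1/2) *\<^sub>R v) = u"
        using v by (simp add: scaleR_matrix_vector_assoc[symmetric] matrix_vector_mult_scaleR)
      have "0 \<le> z \<bullet> (R *v z)" for z
        using assms(1) by (simp add: psd_def)
      then have "z \<bullet> (?W *v z) \<le> z \<bullet> (2 *\<^sub>R ?V *v z)" for z
        by (simp only: scaleR_2 matrix_vector_mult_add_rdistrib inner_add_right
            innovation_cov_def) simp
      then show "((1/2) *\<^sub>R v) \<bullet> (?W *v ((1/2) *\<^sub>R v)) \<le>
          ((1/2) *\<^sub>R v) \<bullet> (2 *\<^sub>R ?V *v ((1/2) *\<^sub>R v))" .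
    qed
    ultimately show ?thesis
      unfolding M1 M2 by simp
  qed
  show "psd M1"
    using quad sym by (simp add: psd_def)
  show "M1 \<preceq>\<^sub>L M2"
    using quad sym by (simp add: loewner_le_def psd_def transpose_diff
        matrix_vector_mult_diff_rdistrib inner_diff_right)
  show "M2 \<preceq>\<^sub>L 2 *\<^sub>R M1"
    using quad sym by (simp add: loewner_le_def psd_def transpose_diff transpose_scalar
        matrix_vector_mult_diff_rdistrib inner_diff_right scaleR_matrix_vector_assoc[symmetric])
qed

section \<open>Optimal location\<close>

text \<open>The weights of \<open>d\<close> and \<open>1 - d\<close> on the endpoints are
  complementary, so the two chord bounds add up to the sum of the endpoint values.\<close>

lemma convex_on_reflect_sum_le:
  fixes f :: "real \<Rightarrow> real"
  assumes "convex_on {0..1} f" "d \<in> {0..1}"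
  shows "f d + f (1 - d) \<le> f 0 + f 1"
proof -
  have "f d \<le> (1 - d) * f 0 + d * f 1"
    using convex_onD[OF assms(1), of d 0 1] assms(2) by simp
  moreover have "f (1 - d) \<le> d * f 0 + (1 - d) * f 1"
    using convex_onD[OF assms(1), of "1 - d" 0 1] assms(2) by simp
  ultimately show ?thesis
    by (simp add: algebra_simps)
qed

theorem corollary1:
  fixes A Q :: "real^'n^'n" and C :: "real^'n^'m" and R :: "real^'m^'m"
    and f :: "real \<Rightarrow> real"
  assumes "psd Q" and "psd R"
    and "f ` {0..1} \<subseteq> {0..1}"
    and "twice_differentiable_on f {0..1}"
    and "convex_on {0..1} f"
    and "antimono_on {0..1} f"
    and "f 0 = 1"
  shows "\<exists>dstar\<in>{0, 1::real}. \<forall>P. admissible C C R R P \<longrightarrow>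
           (\<forall>d\<in>{0..1}. expected_cov A Q C C R R f P dstar \<preceq>\<^sub>L expected_cov A Q C C R R f P d)"
\<comment> \<open>Identical sensors make the expected covariance symmetric under swapping
  \<open>d\<close> and \<open>1 - d\<close>, so both endpoints are equally good and 0 is
  taken.\<close>
proof (rule bexI[of _ 0], intro allI impI ballI)
  fix P :: "real^'n^'n" and d :: real
  assume P: "admissible C C R R P" and d: "d \<in> {0..1}"
  define p q c where "p = f d" and "q = f (1 - d)" and "c = f 1"
  define M1 M2 where "M1 = cov_reduction A P C R"
    and "M2 = cov_reduction A P (vstack C C) (block_diag R R)"
  have M: "psd M1" "psd (M2 - M1)" "psd (2 *\<^sub>R M1 - M2)"
    using cov_reduction_two_packets[OF assms(2) P, of A]
    by (simp_all add: M1_def M2_def loewner_le_def)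
  have range: "f x \<in> {0..1}" if "x \<in> {0..1}" for x
    using assms(3) that by blast
  have p: "p \<in> {0..1}" and q: "q \<in> {0..1}" and c: "c \<in> {0..1}"
    using d by (auto simp: p_def q_def c_def intro!: range simp del: atLeastAtMost_iff) auto
  have pqc: "p + q \<le> 1 + c"
    using convex_on_reflect_sum_le[OF assms(5) d] assms(7) by (simp add: p_def q_def c_def)
  have J: "expected_cov A Q C C R R f P d = A ** P ** transpose A + Q
      - (p * q) *\<^sub>R M2 - (p * (1 - q)) *\<^sub>R M1 - ((1 - p) * q) *\<^sub>R M1"
    unfolding p_def q_def M1_def M2_def
    by (rule expected_cov_eq) (use p q in \<open>simp_all only: p_def q_def\<close>)
  \<comment> \<open>At 0 the first packet always arrives, as \<open>f 0 = 1\<close>, and the second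
    arrives with probability \<open>c\<close>.\<close>
  have J0: "expected_cov A Q C C R R f P 0 = A ** P ** transpose A + Q
      - c *\<^sub>R M2 - (1 - c) *\<^sub>R M1"
    using expected_cov_eq[of f 0 A Q C C R R P] c assms(7)
    by (simp add: c_def M1_def M2_def)
  have "psd (expected_cov A Q C C R R f P d - expected_cov A Q C C R R f P 0)"
  proof (cases "p * q \<le> c")
    case True
    have "expected_cov A Q C C R R f P d - expected_cov A Q C C R R f P 0 =
        (c - p * q) *\<^sub>R (M2 - M1) + ((1 - p) * (1 - q)) *\<^sub>R M1"
      unfolding J J0 by (simp add: algebra_simps)
    with True p q M show ?thesis
      by (simp add: psd_add psd_scaleR)
  next
    case False
    \<comment> \<open>Substituting \<open>M2 - M1 = M1 - (2 *\<^sub>R M1 - M2)\<close> makes the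
      first coefficient positive; the one left on \<open>M1\<close> is
      \<open>(1 - p) * (1 - q) - p * q + c\<close>.\<close>
    have "expected_cov A Q C C R R f P d - expected_cov A Q C C R R f P 0 =
        (p * q - c) *\<^sub>R (2 *\<^sub>R M1 - M2) + (1 + c - p - q) *\<^sub>R M1"
      unfolding J J0 by (simp add: vec_eq_iff algebra_simps)
    with False pqc M show ?thesis
      by (simp add: psd_add psd_scaleR)
  qed
  then show "expected_cov A Q C C R R f P 0 \<preceq>\<^sub>L expected_cov A Q C C R R f P d"
    by (simp add: loewner_le_def)
qed simp

end
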